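(* The poset $\mathcal{W}$ of all weak Hausdorff shift-continuous topologies on $\mathcal{C}^0$, ordered by inclusion, is order isomorphic to the poset $\mathcal{SIF}^1\times\mathcal{SIF}^1$ (with the coordinatewise order).
   Context: All topologies are assumed Hausdorff. $\omega$ is the set of non-negative integers. The bicyclic monoid $\mathcal{C}$ is the set $\omega\times\omega$ with the operation $(a,b)\cdot(c,d)=(a+c-b,d)$ if $b\le c$ and $(a,b)\cdot(c,d)=(a,d+b-c)$ if $b>c$. $\mathcal{C}^0=\mathcal{C}\cup\{0\}$ is $\mathcal{C}$ with an adjoined zero $0$. A topology on a semigroup is shift-continuous if the semigroup operation is separately continuous. The topology $\tau_{\min}$ on $\mathcal{C}^0$ (the coarsest Hausdorff topology making $\mathcal{C}^0$ a topological inverse semigroup) is the one in which all elements of $\mathcal{C}$ are isolated and the sets $C_n=\{0\}\cup\{(k,m)\mid k,m>n\}$, $n\in\omega$, form an open neighborhood base at $0$. A Hausdorff topology $\tau$ on $\mathcal{C}^0$ is weak if $\tau\subseteq\tau_{\min}$. $\mathcal{W}$ is the set of all weak Hausdorff shift-continuous topologies on $\mathcal{C}^0$, ordered by $\tau_1\le\tau_2$ iff $\tau_1\subseteq\tau_2$. Filters do not contain $\emptyset$. For $n\in\mathbb{Z}$ and $A\subseteq\omega$ put $n+A=\{n+x\mid x\in A\}\cap\omega$. A filter $\mathcal{F}$ on $\omega$ is shift-invariant if every cofinite subset of $\omega$ belongs to $\mathcal{F}$ and for each $F\in\mathcal{F}$ and $n\in\mathbb{Z}$ there exists $H\in\mathcal{F}$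 with $n+H\subseteq F$. $\mathcal{SIF}$ is the set of all shift-invariant filters on $\omega$, ordered by inclusion, and $\mathcal{SIF}^1=\mathcal{SIF}\sqcup\{1\}$, where the order is extended by letting $1$ be the greatest element. *)

theory Defs
  imports "HOL-Analysis.Analysis"
begin

section \<open>The bicyclic monoid with an adjoined zero\<close>

fun bicyclic_mult :: "nat \<times> nat \<Rightarrow> nat \<times> nat \<Rightarrow> nat \<times> nat" where
  "bicyclic_mult (a, b) (c, d) = (if b \<le> c then (a + c - b, d) else (a, d + b - c))"

datatype bicyclic0 = Zero | Elem "nat \<times> nat"

instantiation bicyclic0 :: "{semigroup_mult, mult_zero}"
begin

definition zero_bicyclic0 :: bicyclic0 where
  "0 = Zero"

fun times_bicyclic0 :: "bicyclic0 \<Rightarrow> bicyclic0 \<Rightarrow> bicyclic0" where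
  "Elem x * Elem y = Elem (bicyclic_mult x y)"
| "Zero * y = Zero"
| "x * Zero = Zero"

instance
proof
  fix x y z :: bicyclic0
  show "x * y * z = x * (y * z)"
    by (cases x; cases y; cases z) auto
  show "0 * x = 0" "x * 0 = 0"
    by (cases x; simp add: zero_bicyclic0_def)+
qed

end


section \<open>Weak Hausdorff shift-continuous topologies\<close>

definition shift_continuous :: "'a::semigroup_mult topology \<Rightarrow> bool" where
  "shift_continuous \<tau> \<longleftrightarrow>
     (\<forall>a. continuous_map \<tau> \<tau> (\<lambda>x. a * x) \<and> continuous_map \<tau> \<tau> (\<lambda>x. x * a))"

definition tau_min_nhd :: "nat \<Rightarrow> bicyclic0 set" where
  "tau_min_nhd n = {0} \<union> {Elem (k, m) | k m. k > n \<and> m > n}"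

definition tau_min :: "bicyclic0 topology" where
  "tau_min = topology (\<lambda>U. 0 \<in> U \<longrightarrow> (\<exists>n. tau_min_nhd n \<subseteq> U))"

lemma openin_tau_min: "openin tau_min U \<longleftrightarrow> (0 \<in> U \<longrightarrow> (\<exists>n. tau_min_nhd n \<subseteq> U))"
proof -
  have anti: "tau_min_nhd (max m n) \<subseteq> tau_min_nhd m \<inter> tau_min_nhd n" for m n
    by (auto simp: tau_min_nhd_def)
  have "istopology (\<lambda>U. 0 \<in> U \<longrightarrow> (\<exists>n. tau_min_nhd n \<subseteq> U))"
    unfolding istopology_def
  proof (intro conjI allI impI)
    fix S T :: "bicyclic0 set"
    assume "0 \<in> S \<longrightarrow> (\<exists>n. tau_min_nhd n \<subseteq> S)" "0 \<in> T \<longrightarrow> (\<exists>n. tau_min_nhd n \<subseteq> T)"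
      and "0 \<in> S \<inter> T"
    then obtain m n where "tau_min_nhd m \<subseteq> S" "tau_min_nhd n \<subseteq> T"
      by blast
    then show "\<exists>n. tau_min_nhd n \<subseteq> S \<inter> T"
      using anti [of m n] by (intro exI [of _ "max m n"]) auto
  next
    fix K :: "bicyclic0 set set"
    assume K: "\<forall>S\<in>K. 0 \<in> S \<longrightarrow> (\<exists>n. tau_min_nhd n \<subseteq> S)" and "0 \<in> \<Union> K"
    then obtain S n where "S \<in> K" "tau_min_nhd n \<subseteq> S"
      by blast
    then show "\<exists>n. tau_min_nhd n \<subseteq> \<Union> K"
      by (meson Union_upper order_trans)
  qed
  then show ?thesis
    by (simp add: tau_min_def)
qed

definition topology_le :: "'a topology \<Rightarrow> 'a topology \<Rightarrow> bool" where
  "topology_le \<tau>1 \<tau>2 \<longleftrightarrow> {U. openin \<tau>1 U} \<subseteq> {U. openin \<tau>2 U}"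

text \<open>The condition on \<^const>\<open>topspace\<close> says that the topology is one on all of the type.\<close>

definition weak_topologies :: "bicyclic0 topology set" where
  "weak_topologies =
     {\<tau>. topspace \<tau> = UNIV \<and> Hausdorff_space \<tau> \<and> shift_continuous \<tau> \<and> topology_le \<tau> tau_min}"


section \<open>Shift-invariant filters\<close>

definition filter_sets :: "'a filter \<Rightarrow> 'a set set" where
  "filter_sets F = {A. \<forall>\<^sub>F x in F. x \<in> A}"

definition shift_set :: "int \<Rightarrow> nat set \<Rightarrow> nat set" where
  "shift_set n A = {k. \<exists>x\<in>A. int k = n + int x}"

text \<open>The library type of filters includes the improper filter \<^const>\<open>bot\<close>, which contains the
  empty set and is therefore excluded.\<close>

definition shift_invariant_filters :: "nat filter set" where
  "shift_invariant_filters =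
     {F. F \<noteq> bot \<and> (\<forall>A. finite (- A) \<longrightarrow> A \<in> filter_sets F) \<and>
         (\<forall>A\<in>filter_sets F. \<forall>n. \<exists>H\<in>filter_sets F. shift_set n H \<subseteq> A)}"

text \<open>Inclusion of filters as families of sets; this is the reverse of the library order
  \<open>\<le>\<close> on filters.\<close>

definition filter_incl :: "'a filter \<Rightarrow> 'a filter \<Rightarrow> bool" where
  "filter_incl F G \<longleftrightarrow> filter_sets F \<subseteq> filter_sets G"

datatype 'a adjoin_one = Base 'a | One

fun adjoin_one_le :: "('a \<Rightarrow> 'a \<Rightarrow> bool) \<Rightarrow> 'a adjoin_one \<Rightarrow> 'a adjoin_one \<Rightarrow> bool" where
  "adjoin_one_le le x One \<longleftrightarrow> True"
| "adjoin_one_le le One (Base y) \<longleftrightarrow> False"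
| "adjoin_one_le le (Base x) (Base y) \<longleftrightarrow> le x y"

definition SIF1 :: "nat filter adjoin_one set" where
  "SIF1 = insert One (Base ` shift_invariant_filters)"

abbreviation SIF1_le :: "nat filter adjoin_one \<Rightarrow> nat filter adjoin_one \<Rightarrow> bool" where
  "SIF1_le \<equiv> adjoin_one_le filter_incl"


section \<open>Products and isomorphisms of ordered sets\<close>

definition prod_le ::
  "('a \<Rightarrow> 'a \<Rightarrow> bool) \<Rightarrow> ('b \<Rightarrow> 'b \<Rightarrow> bool) \<Rightarrow> 'a \<times> 'b \<Rightarrow> 'a \<times> 'b \<Rightarrow> bool" where
  "prod_le le1 le2 p q \<longleftrightarrow> le1 (fst p) (fst q) \<and> le2 (snd p) (snd q)"

definition order_isomorphic ::
  "'a set \<Rightarrow> ('a \<Rightarrow> 'a \<Rightarrow> bool) \<Rightarrow> 'b set \<Rightarrow> ('b \<Rightarrow> 'b \<Rightarrow> bool) \<Rightarrow> bool" where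
  "order_isomorphic A leA B leB \<longleftrightarrow>
     (\<exists>f. bij_betw f A B \<and> (\<forall>x\<in>A. \<forall>y\<in>A. leA x y \<longleftrightarrow> leB (f x) (f y)))"

end

theory Submission
  imports Defs
begin

text \<open>
  Every nonzero point of a Hausdorff shift-continuous topology on the semigroup is isolated, so the
  topology is determined by the neighbourhood filter \<open>N\<close> of zero; inclusion of topologies becomes
  the reverse of the order \<open>\<le>\<close> on these filters. The conditions defining a weak topology turn into
  those of \<open>weak_nhds\<close>: the filter is coarser than that of \<^const>\<open>tau_min\<close>, avoids every nonzero
  point, and is preserved by all left and right shifts.

  Weakness says that every neighbourhood of zero contains a corner
  \<open>{(k, m). k > n \<and> m > n}\<close>, so what is left to know is how it meets the finitely many rows
  \<open>k \<le> n\<close> and columns \<open>m \<le> n\<close>. Left multiplication by \<open>(k, 0)\<close> maps row \<open>0\<close> onto row \<open>k\<close>, and left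
  multiplication by \<open>(0, k)\<close> maps it back. As both preserve \<open>N\<close>, all rows carry the same trace of \<open>N\<close>;
  dually, all columns carry the same trace. Right multiplication by \<open>(0, n)\<close> and by \<open>(n, 0)\<close> moves
  row \<open>0\<close> by \<open>n\<close> to the right and to the left, which is why the trace is a shift-invariant filter,
  possibly the improper one. The improper filter occurs exactly when some neighbourhood of zero misses
  the row, and it plays the part of the added element \<open>1\<close>.

  Conversely, two such filters \<open>F\<close> and \<open>G\<close> can be prescribed independently: a set is a
  neighbourhood of zero in \<open>zero_nhds F G\<close> when it contains zero and a corner, meets every row in a
  member of \<open>F\<close>, and every column in a member of \<open>G\<close>. The two constructions are monotone and
  inverse to each other (\<open>zero_nhds_traces\<close>, \<open>row_filter_zero_nhds\<close>, \<open>col_filter_zero_nhds\<close>).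

  The map \<open>(a, b) \<mapsto> (b, a)\<close> reverses products and exchanges rows with columns, so one side of each
  argument suffices.
\<close>


section \<open>Involution and isolated points of the semigroup\<close>

lemma bicyclic0_cases [case_names zero Elem]:
  obtains "x = 0" | k m where "x = Elem (k, m)"
  by (cases x) (auto simp: zero_bicyclic0_def)

lemma Elem_neq_zero [simp]: "Elem p \<noteq> 0" "0 \<noteq> Elem p"
  by (simp_all add: zero_bicyclic0_def)

primrec flip :: "bicyclic0 \<Rightarrow> bicyclic0" where
  "flip Zero = Zero"
| "flip (Elem p) = Elem (snd p, fst p)"

lemma flip_zero [simp]: "flip 0 = 0"
  by (simp add: zero_bicyclic0_def)

lemma flip_flip [simp]: "flip (flip x) = x"
  by (cases x) auto

lemma flip_mult: "flip (x * y) = flip y * flip x"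
  by (cases x; cases y) auto

lemma flip_eq_zero_iff [simp]: "flip x = 0 \<longleftrightarrow> x = 0"
  by (cases x) (auto simp: zero_bicyclic0_def)

text \<open>Fixed-point sets of continuous self-maps of a Hausdorff space are closed. Right multiplication
  by the idempotent \<open>(1, 1)\<close> fixes everything outside column \<open>0\<close>, left multiplication everything
  outside row \<open>0\<close>; so the identity \<open>(0, 0)\<close> is isolated. Multiplying by \<open>(0, a)\<close> and \<open>(b, 0)\<close> carries
  \<open>(a, b)\<close> to \<open>(0, 0)\<close>, and only finitely many points have this image.\<close>

lemma openin_singleton_Elem:
  assumes top: "topspace \<tau> = UNIV" and haus: "Hausdorff_space \<tau>" and cont: "shift_continuous \<tau>"
  shows "openin \<tau> {Elem p}"
proof -
  obtain a b where p: "p = (a, b)"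
    by (cases p)
  have left: "continuous_map \<tau> \<tau> (\<lambda>x. s * x)" and right: "continuous_map \<tau> \<tau> (\<lambda>x. x * s)" for s
    using cont by (auto simp: shift_continuous_def)
  have closed_fix: "closedin \<tau> {x. f x = x}" if "continuous_map \<tau> \<tau> f" for f
    using closedin_continuous_maps_eq [OF haus that continuous_map_id] top by simp
  have "closedin \<tau> ({x. x * Elem (1, 1) = x} \<union> {x. Elem (1, 1) * x = x})"
    by (intro closedin_Un closed_fix left right)
  moreover have "- ({x. x * Elem (1, 1) = x} \<union> {x. Elem (1, 1) * x = x}) = {Elem (0, 0)}"
  proof -
    have "\<not> (x * Elem (1, 1) = x \<or> Elem (1, 1) * x = x) \<longleftrightarrow> x = Elem (0, 0)" for x
      by (cases x rule: bicyclic0_cases) auto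
    then show ?thesis by blast
  qed
  ultimately have unit: "openin \<tau> {Elem (0, 0)}"
    using top by (simp add: closedin_def Compl_eq_Diff_UNIV)
  define S where "S = {x. Elem (0, a) * x * Elem (b, 0) = Elem (0, 0)}"
  have "continuous_map \<tau> \<tau> (\<lambda>x. Elem (0, a) * x * Elem (b, 0))"
    using continuous_map_compose [OF left right] by (simp add: o_def)
  from openin_continuous_map_preimage [OF this unit] have "openin \<tau> S"
    using top by (simp add: S_def)
  moreover have "finite S"
  proof (rule finite_subset)
    show "S \<subseteq> Elem ` ({..a} \<times> {..b})"
    proof
      fix x assume "x \<in> S"
      then show "x \<in> Elem ` ({..a} \<times> {..b})"
        by (cases x rule: bicyclic0_cases) (auto simp: S_def split: if_splits)
    qed
  qed auto
  then have "closedin \<tau> (S - {Elem p})"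
    using Hausdorff_imp_t1_space [OF haus] top by (simp add: t1_space_closedin_finite)
  ultimately have "openin \<tau> (S - (S - {Elem p}))"
    by (intro openin_diff)
  moreover have "S - (S - {Elem p}) = {Elem p}"
    by (auto simp: S_def p)
  ultimately show ?thesis
    by simp
qed


section \<open>Topologies with at most one non-isolated point\<close>

text \<open>All points other than zero are isolated, and \<open>N\<close> prescribes the neighbourhoods of zero. The
  filter \<open>N\<close> is recovered as the neighbourhood filter of zero only if all its members contain zero,
  hence the hypothesis of \<open>nhdsin_zero_topology\<close>.\<close>

definition zero_topology :: "'a::zero filter \<Rightarrow> 'a topology" where
  "zero_topology N = topology (\<lambda>U. 0 \<in> U \<longrightarrow> (\<forall>\<^sub>F x in N. x \<in> U))"

lemma openin_zero_topology:
  "openin (zero_topology N) U \<longleftrightarrow> (0 \<in> U \<longrightarrow> (\<forall>\<^sub>F x in N. x \<in> U))"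
proof -
  have "istopology (\<lambda>U. 0 \<in> U \<longrightarrow> (\<forall>\<^sub>F x in N. x \<in> U))"
    unfolding istopology_def
  proof (intro conjI allI impI)
    fix K assume K: "\<forall>S\<in>K. 0 \<in> S \<longrightarrow> (\<forall>\<^sub>F x in N. x \<in> S)" and "0 \<in> \<Union> K"
    then obtain S where "S \<in> K" "\<forall>\<^sub>F x in N. x \<in> S"
      by blast
    then show "\<forall>\<^sub>F x in N. x \<in> \<Union> K"
      by (auto elim!: eventually_mono)
  qed (simp add: eventually_conj_iff)
  then show ?thesis
    by (simp add: zero_topology_def)
qed

lemma topspace_zero_topology [simp]: "topspace (zero_topology N) = UNIV"
  using openin_subset [of "zero_topology N" UNIV] by (simp add: openin_zero_topology top_unique)

lemma nhdsin_zero_topology: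
  assumes "\<And>P. eventually P N \<Longrightarrow> P 0"
  shows "nhdsin (zero_topology N) 0 = N"
proof (rule filter_eqI)
  fix P
  show "eventually P (nhdsin (zero_topology N) 0) \<longleftrightarrow> eventually P N"
  proof
    assume "eventually P (nhdsin (zero_topology N) 0)"
    then obtain S where "0 \<in> S" "openin (zero_topology N) S" "\<forall>x\<in>S. P x"
      by (auto simp: eventually_nhdsin)
    then show "eventually P N"
      by (simp add: openin_zero_topology eventually_mono)
  next
    assume "eventually P N"
    then show "eventually P (nhdsin (zero_topology N) 0)"
      using assms [of P] by (auto simp: eventually_nhdsin openin_zero_topology
          intro!: exI [of _ "Collect P"])
  qed
qed

lemma zero_topology_nhdsin:
  assumes "topspace \<tau> = UNIV" and iso: "\<And>x. x \<noteq> 0 \<Longrightarrow> openin \<tau> {x}"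
  shows "zero_topology (nhdsin \<tau> 0) = \<tau>"
proof -
  have "openin \<tau> U" if "0 \<in> U \<longrightarrow> (\<forall>\<^sub>F x in nhdsin \<tau> 0. x \<in> U)" for U
  proof (subst openin_subopen, intro ballI)
    fix x assume "x \<in> U"
    then show "\<exists>T. openin \<tau> T \<and> x \<in> T \<and> T \<subseteq> U"
      using that iso [of x] assms(1) by (cases "x = 0") (auto simp: eventually_nhdsin)
  qed
  moreover have "\<forall>\<^sub>F x in nhdsin \<tau> 0. x \<in> U" if "openin \<tau> U" "0 \<in> U" for U
    using that by (auto simp: eventually_nhdsin)
  ultimately show ?thesis
    unfolding topology_eq openin_zero_topology by blast
qed

lemma eventually_nhdsin_tau_min:
  "eventually P (nhdsin tau_min 0) \<longleftrightarrow> P 0 \<and> (\<exists>n. \<forall>k>n. \<forall>m>n. P (Elem (k, m)))"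
proof -
  have "openin tau_min UNIV"
    by (simp add: openin_tau_min)
  then have top: "topspace tau_min = UNIV"
    using openin_subset top_unique by blast
  have "eventually P (nhdsin tau_min 0) \<longleftrightarrow> (\<exists>n. tau_min_nhd n \<subseteq> Collect P)"
  proof
    assume "eventually P (nhdsin tau_min 0)"
    then obtain S where "openin tau_min S" "0 \<in> S" "S \<subseteq> Collect P"
      by (auto simp: eventually_nhdsin top)
    then show "\<exists>n. tau_min_nhd n \<subseteq> Collect P"
      by (auto simp: openin_tau_min)
  next
    assume "\<exists>n. tau_min_nhd n \<subseteq> Collect P"
    then obtain n where n: "tau_min_nhd n \<subseteq> Collect P"
      by blast
    have "openin tau_min (tau_min_nhd n)" "0 \<in> tau_min_nhd n"
      by (auto simp: openin_tau_min tau_min_nhd_def)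
    then show "eventually P (nhdsin tau_min 0)"
      using n by (auto simp: eventually_nhdsin)
  qed
  also have "\<dots> \<longleftrightarrow> P 0 \<and> (\<exists>n. \<forall>k>n. \<forall>m>n. P (Elem (k, m)))"
    by (auto simp: tau_min_nhd_def subset_iff)
  finally show ?thesis .
qed


section \<open>Neighbourhood filters of zero\<close>

lemma filterlim_flip: "filterlim f F G \<Longrightarrow> filterlim (\<lambda>x. flip (f x)) (filtermap flip F) G"
  unfolding filterlim_def using filtermap_mono [of "filtermap f G" F flip]
  by (simp add: filtermap_filtermap)

lemma filtermap_flip_flip [simp]: "filtermap flip (filtermap flip F) = F"
  by (simp add: filtermap_filtermap)

definition weak_nhds :: "bicyclic0 filter \<Rightarrow> bool" where
  "weak_nhds N \<longleftrightarrow> nhdsin tau_min 0 \<le> N \<and> (\<forall>x. x \<noteq> 0 \<longrightarrow> (\<forall>\<^sub>F y in N. y \<noteq> x)) \<and>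
     (\<forall>a. filterlim (\<lambda>x. a * x) N N \<and> filterlim (\<lambda>x. x * a) N N)"

lemma weak_nhdsD:
  assumes "weak_nhds N"
  shows "nhdsin tau_min 0 \<le> N" and "x \<noteq> 0 \<Longrightarrow> \<forall>\<^sub>F y in N. y \<noteq> x"
    and "filterlim (\<lambda>x. a * x) N N" and "filterlim (\<lambda>x. x * a) N N"
  using assms by (simp_all add: weak_nhds_def)

lemma weak_nhds_at_zero:
  assumes "weak_nhds N" "eventually P N"
  shows "P 0"
  using filter_leD [OF weak_nhdsD(1) [OF assms(1)] assms(2)] by (simp add: eventually_nhdsin_tau_min)

lemma weak_nhds_flip:
  assumes "weak_nhds N"
  shows "weak_nhds (filtermap flip N)"
  unfolding weak_nhds_def
proof (intro conjI allI impI)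
  show "nhdsin tau_min 0 \<le> filtermap flip N"
  proof (rule filter_leI)
    fix P assume "eventually P (filtermap flip N)"
    then have "eventually (\<lambda>x. P (flip x)) (nhdsin tau_min 0)"
      using filter_leD [OF weak_nhdsD(1) [OF assms]] by (simp add: eventually_filtermap)
    then show "eventually P (nhdsin tau_min 0)"
      by (auto simp: eventually_nhdsin_tau_min)
  qed
next
  fix x :: bicyclic0 assume "x \<noteq> 0"
  then have "\<forall>\<^sub>F y in N. y \<noteq> flip x"
    using weak_nhdsD(2) [OF assms] by simp
  then have "\<forall>\<^sub>F y in N. flip y \<noteq> x"
    by (rule eventually_mono) auto
  then show "\<forall>\<^sub>F y in filtermap flip N. y \<noteq> x"
    by (simp add: eventually_filtermap)
next
  fix a
  have "filterlim (\<lambda>x. flip (x * flip a)) (filtermap flip N) N"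
    "filterlim (\<lambda>x. flip (flip a * x)) (filtermap flip N) N"
    by (intro filterlim_flip weak_nhdsD [OF assms])+
  then show "filterlim (\<lambda>x. a * x) (filtermap flip N) (filtermap flip N)"
    "filterlim (\<lambda>x. x * a) (filtermap flip N) (filtermap flip N)"
    by (simp_all add: flip_mult filterlim_filtermap)
qed

lemma weak_nhds_nhdsin:
  assumes "\<tau> \<in> weak_topologies"
  shows "weak_nhds (nhdsin \<tau> 0)"
proof -
  have top: "topspace \<tau> = UNIV" and haus: "Hausdorff_space \<tau>" and cont: "shift_continuous \<tau>"
    and weak: "topology_le \<tau> tau_min"
    using assms by (auto simp: weak_topologies_def)
  have "topspace tau_min = UNIV"
    using weak openin_topspace [of \<tau>] openin_subset [of tau_min UNIV]
    by (auto simp: topology_le_def top)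
  then have le: "nhdsin tau_min 0 \<le> nhdsin \<tau> 0"
    using weak top by (intro filter_leI) (auto simp: eventually_nhdsin topology_le_def)
  have sep: "\<forall>\<^sub>F y in nhdsin \<tau> 0. y \<noteq> x" if "x \<noteq> 0" for x
  proof -
    have "openin \<tau> (UNIV - {x})"
      using Hausdorff_imp_t1_space [OF haus] top
      by (simp add: t1_space_closedin_singleton closedin_def)
    then show ?thesis
      using that by (auto simp: eventually_nhdsin)
  qed
  have lim: "filterlim f (nhdsin \<tau> 0) (nhdsin \<tau> 0)"
    if "continuous_map \<tau> \<tau> f" "f 0 = 0" for f
    unfolding filterlim_iff
  proof (intro allI impI)
    fix P assume "eventually P (nhdsin \<tau> 0)"
    then obtain S where "openin \<tau> S" "0 \<in> S" "\<forall>x\<in>S. P x"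
      by (auto simp: eventually_nhdsin top)
    moreover from this have "openin \<tau> {x. f x \<in> S}"
      using openin_continuous_map_preimage [OF that(1)] top by fastforce
    ultimately show "\<forall>\<^sub>F x in nhdsin \<tau> 0. P (f x)"
      using that(2) by (auto simp: eventually_nhdsin intro!: exI [of _ "{x. f x \<in> S}"])
  qed
  have "filterlim (\<lambda>x. a * x) (nhdsin \<tau> 0) (nhdsin \<tau> 0)"
    "filterlim (\<lambda>x. x * a) (nhdsin \<tau> 0) (nhdsin \<tau> 0)" for a
    using cont by (auto simp: shift_continuous_def intro!: lim)
  with le sep show ?thesis
    by (simp add: weak_nhds_def)
qed

lemma zero_topology_nhdsin_weak:
  assumes "\<tau> \<in> weak_topologies"
  shows "zero_topology (nhdsin \<tau> 0) = \<tau>"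
proof (rule zero_topology_nhdsin)
  show "topspace \<tau> = UNIV"
    using assms by (simp add: weak_topologies_def)
  show "openin \<tau> {x}" if "x \<noteq> 0" for x
    using assms that openin_singleton_Elem [of \<tau>]
    by (cases x rule: bicyclic0_cases) (auto simp: weak_topologies_def)
qed

lemma zero_topology_weak:
  assumes "weak_nhds N"
  shows "zero_topology N \<in> weak_topologies"
proof -
  have sep: "\<exists>U V. openin (zero_topology N) U \<and> openin (zero_topology N) V \<and>
      x \<in> U \<and> y \<in> V \<and> disjnt U V" if "x \<noteq> y" "y \<noteq> 0" for x y
    using that assms
    by (intro exI [of _ "- {y}"] exI [of _ "{y}"]) (auto simp: openin_zero_topology weak_nhds_def)
  have "Hausdorff_space (zero_topology N)"
    unfolding Hausdorff_space_def
  proof (intro allI impI)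
    fix x y assume "x \<in> topspace (zero_topology N) \<and> y \<in> topspace (zero_topology N) \<and> x \<noteq> y"
    then show "\<exists>U V. openin (zero_topology N) U \<and> openin (zero_topology N) V \<and>
        x \<in> U \<and> y \<in> V \<and> disjnt U V"
      using sep [of x y] sep [of y x] by (cases "y = 0") (simp, metis disjnt_sym, simp)
  qed
  moreover have "continuous_map (zero_topology N) (zero_topology N) f"
    if "filterlim f N N" "f 0 = 0" for f
    using eventually_compose_filterlim [OF _ that(1)] that(2)
    by (auto simp: continuous_map_def openin_zero_topology)
  then have "shift_continuous (zero_topology N)"
    using weak_nhdsD(3,4) [OF assms] by (simp add: shift_continuous_def)
  moreover have "openin tau_min U" if "openin (zero_topology N) U" for U
  proof -
    have "0 \<in> U \<Longrightarrow> \<forall>\<^sub>F x in nhdsin tau_min 0. x \<in> U"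
      using that filter_leD [OF weak_nhdsD(1) [OF assms]] by (simp add: openin_zero_topology)
    then show ?thesis
      unfolding openin_tau_min eventually_nhdsin_tau_min tau_min_nhd_def by blast
  qed
  then have "topology_le (zero_topology N) tau_min"
    by (auto simp: topology_le_def)
  ultimately show ?thesis
    by (simp add: weak_topologies_def)
qed

lemma topology_le_iff_nhdsin:
  assumes "\<sigma> \<in> weak_topologies" "\<tau> \<in> weak_topologies"
  shows "topology_le \<sigma> \<tau> \<longleftrightarrow> nhdsin \<tau> 0 \<le> nhdsin \<sigma> 0"
proof
  assume "topology_le \<sigma> \<tau>"
  then show "nhdsin \<tau> 0 \<le> nhdsin \<sigma> 0"
    using assms
    by (intro filter_leI) (auto simp: weak_topologies_def eventually_nhdsin topology_le_def)
next
  assume "nhdsin \<tau> 0 \<le> nhdsin \<sigma> 0"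
  then have "topology_le (zero_topology (nhdsin \<sigma> 0)) (zero_topology (nhdsin \<tau> 0))"
    by (auto simp: topology_le_def openin_zero_topology intro: filter_leD)
  then show "topology_le \<sigma> \<tau>"
    using assms by (simp add: zero_topology_nhdsin_weak)
qed


section \<open>Shift-stable filters\<close>

text \<open>Shift-invariance in terms of filter limits, for possibly improper filters. The truncated
  subtraction is harmless, since \<open>n \<le> m\<close> holds eventually.\<close>

definition shift_stable :: "nat filter \<Rightarrow> bool" where
  "shift_stable F \<longleftrightarrow> F \<le> sequentially \<and>
     (\<forall>n. filterlim (\<lambda>m. m + n) F F \<and> filterlim (\<lambda>m. m - n) F F)"

lemma le_sequentially_iff: "F \<le> sequentially \<longleftrightarrow> (\<forall>i. \<forall>\<^sub>F m in F. m \<noteq> i)"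
proof
  assume "F \<le> sequentially"
  then show "\<forall>i. \<forall>\<^sub>F m in F. m \<noteq> i"
    by (auto simp: cofinite_eq_sequentially [symmetric] eventually_cofinite intro: filter_leD)
next
  assume F: "\<forall>i. \<forall>\<^sub>F m in F. m \<noteq> i"
  show "F \<le> sequentially"
  proof (rule filter_leI)
    fix P :: "nat \<Rightarrow> bool"
    assume "eventually P sequentially"
    then obtain n where n: "\<And>m. m \<ge> n \<Longrightarrow> P m"
      by (auto simp: eventually_sequentially)
    have "\<forall>\<^sub>F m in F. \<forall>i\<in>{..<n}. m \<noteq> i"
      using F by (intro eventually_ball_finite) auto
    moreover have "P m" if "\<forall>i\<in>{..<n}. m \<noteq> i" for m
      using that n [of m] by (cases "n \<le> m") auto
    ultimately show "eventually P F"
      by (simp add: eventually_mono)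
  qed
qed

lemma shift_stableD:
  assumes "shift_stable F"
  shows "F \<le> sequentially" and "\<forall>\<^sub>F m in F. n \<le> m" and "\<forall>\<^sub>F m in F. m \<noteq> n"
    and "filterlim (\<lambda>m. m + n) F F" and "filterlim (\<lambda>m. m - n) F F"
proof -
  show seq: "F \<le> sequentially"
    using assms by (simp add: shift_stable_def)
  show "\<forall>\<^sub>F m in F. n \<le> m"
    by (rule filter_leD [OF seq eventually_ge_at_top])
  show "\<forall>\<^sub>F m in F. m \<noteq> n"
    using seq by (simp add: le_sequentially_iff)
qed (use assms in \<open>simp_all add: shift_stable_def\<close>)

lemma shift_invariant_filters_iff:
  "F \<in> shift_invariant_filters \<longleftrightarrow> F \<noteq> bot \<and> shift_stable F"
proof
  assume "F \<in> shift_invariant_filters"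
  then have proper: "F \<noteq> bot" and cofin: "\<And>A. finite (- A) \<Longrightarrow> \<forall>\<^sub>F m in F. m \<in> A"
    and shift: "\<And>A n. \<forall>\<^sub>F m in F. m \<in> A \<Longrightarrow> \<exists>H. (\<forall>\<^sub>F m in F. m \<in> H) \<and> shift_set n H \<subseteq> A"
    by (auto simp: shift_invariant_filters_def filter_sets_def)
  have seq: "F \<le> sequentially"
    using cofin [of "- {i}" for i] by (simp add: le_sequentially_iff)
  have "filterlim (\<lambda>m. m + n) F F" for n
    unfolding filterlim_iff
  proof (intro allI impI)
    fix P assume "eventually P F"
    then obtain H where H: "\<forall>\<^sub>F m in F. m \<in> H" "shift_set (int n) H \<subseteq> Collect P"
      using shift [of "Collect P" "int n"] by auto
    have "m + n \<in> shift_set (int n) H" if "m \<in> H" for m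
      using that by (auto simp: shift_set_def)
    with H(2) show "\<forall>\<^sub>F m in F. P (m + n)"
      by (intro eventually_mono [OF H(1)]) blast
  qed
  moreover have "filterlim (\<lambda>m. m - n) F F" for n
    unfolding filterlim_iff
  proof (intro allI impI)
    fix P assume "eventually P F"
    then obtain H where H: "\<forall>\<^sub>F m in F. m \<in> H" "shift_set (- int n) H \<subseteq> Collect P"
      using shift [of "Collect P" "- int n"] by auto
    have "\<forall>\<^sub>F m in F. n \<le> m"
      by (rule filter_leD [OF seq eventually_ge_at_top])
    with H(1) show "\<forall>\<^sub>F m in F. P (m - n)"
    proof eventually_elim
      case (elim m)
      then have "m - n \<in> shift_set (- int n) H"
        by (auto simp: shift_set_def intro!: bexI [of _ m])
      with H(2) show ?case
        by blast
    qed
  qed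
  ultimately show "F \<noteq> bot \<and> shift_stable F"
    using proper seq by (simp add: shift_stable_def)
next
  assume F: "F \<noteq> bot \<and> shift_stable F"
  have "\<exists>H. (\<forall>\<^sub>F m in F. m \<in> H) \<and> shift_set n H \<subseteq> A" if A: "\<forall>\<^sub>F m in F. m \<in> A" for A n
  proof (cases "n \<ge> 0")
    case True
    have "\<forall>\<^sub>F m in F. m + nat n \<in> A"
      using F by (intro eventually_compose_filterlim [OF A] shift_stableD) simp
    moreover have "k = x + nat n" if "int k = n + int x" for k x
      using that True by linarith
    then have "shift_set n {m. m + nat n \<in> A} \<subseteq> A"
      by (auto simp: shift_set_def)
    ultimately show ?thesis
      by (intro exI [of _ "{m. m + nat n \<in> A}"]) simp
  next
    case False
    have "\<forall>\<^sub>F m in F. m - nat (- n) \<in> A"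
      using F by (intro eventually_compose_filterlim [OF A] shift_stableD) simp
    moreover have "k = x - nat (- n)" if "int k = n + int x" for k x
      using that False by linarith
    then have "shift_set n {m. m - nat (- n) \<in> A} \<subseteq> A"
      by (auto simp: shift_set_def)
    ultimately show ?thesis
      by (intro exI [of _ "{m. m - nat (- n) \<in> A}"]) simp
  qed
  moreover have "\<forall>\<^sub>F m in F. m \<in> A" if "finite (- A)" for A
  proof (rule filter_leD)
    show "F \<le> cofinite"
      using F by (simp add: shift_stable_def cofinite_eq_sequentially)
    show "\<forall>\<^sub>F m in cofinite. m \<in> A"
      using that by (simp add: eventually_cofinite Compl_eq)
  qed
  ultimately show "F \<in> shift_invariant_filters"
    using F by (simp add: shift_invariant_filters_def filter_sets_def)
qed

text \<open>With this coding the improper filter, which contains all sets, becomes the greatest element \<open>One\<close>.\<close>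

definition filter_code :: "'a filter \<Rightarrow> 'a filter adjoin_one" where
  "filter_code F = (if F = bot then One else Base F)"

lemma filter_incl_iff: "filter_incl F G \<longleftrightarrow> G \<le> F"
proof
  assume le: "filter_incl F G"
  show "G \<le> F"
  proof (rule filter_leI)
    fix P assume "eventually P F"
    then have "Collect P \<in> filter_sets F"
      by (simp add: filter_sets_def)
    then have "Collect P \<in> filter_sets G"
      using le by (auto simp only: filter_incl_def)
    then show "eventually P G"
      by (simp add: filter_sets_def)
  qed
next
  assume "G \<le> F"
  then show "filter_incl F G"
    unfolding filter_incl_def filter_sets_def by (blast intro: filter_leD)
qed

lemma filter_code_le_iff:
  "adjoin_one_le filter_incl (filter_code F) (filter_code G) \<longleftrightarrow> G \<le> F"
  by (simp add: filter_code_def filter_incl_iff bot_unique)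

lemma SIF1_eq: "SIF1 = filter_code ` Collect shift_stable"
proof -
  have "shift_stable bot"
    by (auto simp: shift_stable_def filterlim_def)
  then show ?thesis
    by (fastforce simp: SIF1_def filter_code_def shift_invariant_filters_iff image_iff)
qed


section \<open>Traces on rows and columns\<close>

definition row_filter :: "bicyclic0 filter \<Rightarrow> nat filter" where
  "row_filter N = filtercomap (\<lambda>m. Elem (0, m)) N"

definition col_filter :: "bicyclic0 filter \<Rightarrow> nat filter" where
  "col_filter N = filtercomap (\<lambda>k. Elem (k, 0)) N"

lemma filterlim_row_filter_iff:
  "filterlim g (row_filter N) F \<longleftrightarrow> filterlim (\<lambda>x. Elem (0, g x)) N F"
  by (simp add: row_filter_def filterlim_filtercomap_iff o_def)

lemma row_filter_flip: "row_filter (filtermap flip N) = col_filter N"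
proof (rule filter_eqI)
  fix P
  have "(\<exists>Q. eventually Q (filtermap flip N) \<and> (\<forall>m. Q (Elem (0, m)) \<longrightarrow> P m)) \<longleftrightarrow>
      (\<exists>Q. eventually Q N \<and> (\<forall>k. Q (Elem (k, 0)) \<longrightarrow> P k))" (is "?L \<longleftrightarrow> ?R")
  proof
    assume ?L
    then obtain Q where "eventually (\<lambda>x. Q (flip x)) N" "\<forall>m. Q (Elem (0, m)) \<longrightarrow> P m"
      by (auto simp: eventually_filtermap)
    then show ?R
      by (intro exI [of _ "\<lambda>x. Q (flip x)"]) auto
  next
    assume ?R
    then obtain Q where "eventually Q N" "\<forall>k. Q (Elem (k, 0)) \<longrightarrow> P k"
      by auto
    then show ?L
      by (intro exI [of _ "\<lambda>x. Q (flip x)"]) (auto simp: eventually_filtermap)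
  qed
  then show "eventually P (row_filter (filtermap flip N)) \<longleftrightarrow> eventually P (col_filter N)"
    by (simp add: row_filter_def col_filter_def eventually_filtercomap)
qed

text \<open>Row \<open>k\<close> is the image of row \<open>0\<close> under left multiplication by \<open>(k, 0)\<close>.\<close>

lemma filterlim_row:
  assumes "weak_nhds N"
  shows "filterlim (\<lambda>m. Elem (k, m)) N (row_filter N)"
proof -
  have "filterlim (\<lambda>x. Elem (k, 0) * x) N N"
    by (rule weak_nhdsD(3) [OF assms])
  from filterlim_compose [OF this filterlim_filtercomap [of "\<lambda>m. Elem (0, m)" N]]
  show ?thesis
    by (simp add: row_filter_def)
qed

lemma filterlim_col:
  assumes "weak_nhds N"
  shows "filterlim (\<lambda>k. Elem (k, m)) N (col_filter N)"
proof -
  have "filterlim (\<lambda>k. Elem (m, k)) (filtermap flip N) (col_filter N)"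
    using filterlim_row [OF weak_nhds_flip [OF assms]] by (simp add: row_filter_flip)
  from filterlim_flip [OF this] show ?thesis
    by simp
qed

text \<open>The converse of \<open>filterlim_row\<close>, localised to one row: left multiplication by \<open>(0, k)\<close> brings
  row \<open>k\<close> back to row \<open>0\<close>.\<close>

lemma eventually_row:
  assumes "weak_nhds N" and "\<forall>\<^sub>F m in row_filter N. P (Elem (k, m))"
  shows "\<forall>\<^sub>F x in N. \<forall>m. x = Elem (k, m) \<longrightarrow> P x"
proof -
  obtain Q where Q: "eventually Q N" "\<And>m. Q (Elem (0, m)) \<Longrightarrow> P (Elem (k, m))"
    using assms(2) by (auto simp: row_filter_def eventually_filtercomap)
  have "filterlim (\<lambda>x. Elem (0, k) * x) N N"
    by (rule weak_nhdsD(3) [OF assms(1)])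
  from eventually_compose_filterlim [OF Q(1) this] have "\<forall>\<^sub>F x in N. Q (Elem (0, k) * x)" .
  then show ?thesis
    by eventually_elim (auto intro: Q(2))
qed

lemma eventually_col:
  assumes "weak_nhds N" and "\<forall>\<^sub>F k in col_filter N. P (Elem (k, m))"
  shows "\<forall>\<^sub>F x in N. \<forall>k. x = Elem (k, m) \<longrightarrow> P x"
proof -
  have "\<forall>\<^sub>F x in filtermap flip N. \<forall>k. x = Elem (m, k) \<longrightarrow> P (flip x)"
    using assms by (intro eventually_row weak_nhds_flip) (simp_all add: row_filter_flip)
  then show ?thesis
    by (auto simp: eventually_filtermap elim: eventually_mono)
qed

text \<open>Right multiplication of \<open>(0, m)\<close> by \<open>(0, n)\<close> gives \<open>(0, m + n)\<close>, and right multiplication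
  by \<open>(n, 0)\<close> gives \<open>(0, m - n)\<close> as soon as \<open>n \<le> m\<close>.\<close>

lemma shift_stable_row_filter:
  assumes "weak_nhds N"
  shows "shift_stable (row_filter N)"
proof -
  let ?e = "\<lambda>m. Elem (0, m)"
  have lim: "filterlim ?e N (row_filter N)"
    by (rule filterlim_row [OF assms])
  have right: "filterlim (\<lambda>x. x * a) N N" for a
    by (rule weak_nhdsD(4) [OF assms])
  have seq: "row_filter N \<le> sequentially"
  proof -
    have "\<forall>\<^sub>F m in row_filter N. ?e m \<noteq> ?e i" for i
      by (intro eventually_compose_filterlim [OF _ lim] weak_nhdsD(2) [OF assms]) simp
    then show ?thesis
      by (simp add: le_sequentially_iff)
  qed
  moreover have "filterlim (\<lambda>m. m + n) (row_filter N) (row_filter N)" for n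
  proof -
    have "filterlim (\<lambda>m. ?e m * Elem (0, n)) N (row_filter N)"
      by (rule filterlim_compose [OF right lim])
    moreover have "?e m * Elem (0, n) = ?e (m + n)" for m
      by (simp add: add.commute)
    ultimately show ?thesis
      by (simp only: filterlim_row_filter_iff)
  qed
  moreover have "filterlim (\<lambda>m. m - n) (row_filter N) (row_filter N)" for n
  proof -
    have "\<forall>\<^sub>F m in row_filter N. n \<le> m"
      by (rule filter_leD [OF seq eventually_ge_at_top])
    then have eq: "\<forall>\<^sub>F m in row_filter N. ?e m * Elem (n, 0) = ?e (m - n)"
      by eventually_elim auto
    have "filterlim (\<lambda>m. ?e m * Elem (n, 0)) N (row_filter N)"
      by (rule filterlim_compose [OF right lim])
    then show ?thesis
      by (simp only: filterlim_row_filter_iff filterlim_cong [OF refl refl eq])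
  qed
  ultimately show ?thesis
    by (simp add: shift_stable_def)
qed

lemma shift_stable_col_filter: "weak_nhds N \<Longrightarrow> shift_stable (col_filter N)"
  using shift_stable_row_filter [OF weak_nhds_flip] by (simp add: row_filter_flip)


section \<open>Assembling a neighbourhood filter from its traces\<close>

text \<open>The finest filter that is coarser than the neighbourhood filter of \<^const>\<open>tau_min\<close> and to which
  every row converges along \<open>F\<close> and every column along \<open>G\<close>.\<close>

definition zero_nhds :: "nat filter \<Rightarrow> nat filter \<Rightarrow> bicyclic0 filter" where
  "zero_nhds F G = sup (nhdsin tau_min 0)
     (sup (SUP k. filtermap (\<lambda>m. Elem (k, m)) F) (SUP m. filtermap (\<lambda>k. Elem (k, m)) G))"

lemma eventually_zero_nhds:
  "eventually P (zero_nhds F G) \<longleftrightarrow> eventually P (nhdsin tau_min 0) \<and>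
     (\<forall>k. \<forall>\<^sub>F m in F. P (Elem (k, m))) \<and> (\<forall>m. \<forall>\<^sub>F k in G. P (Elem (k, m)))"
  by (simp add: zero_nhds_def eventually_sup eventually_Sup eventually_filtermap)

lemma zero_nhds_mono: "F \<le> F' \<Longrightarrow> G \<le> G' \<Longrightarrow> zero_nhds F G \<le> zero_nhds F' G'"
  by (intro filter_leI) (auto simp: eventually_zero_nhds intro: filter_leD)

lemma filtermap_flip_zero_nhds: "filtermap flip (zero_nhds F G) = zero_nhds G F"
  by (rule filter_eqI)
    (auto simp: eventually_filtermap eventually_zero_nhds eventually_nhdsin_tau_min)

text \<open>Left multiplication by \<open>(c, d)\<close> maps a row \<open>k \<ge> d\<close> identically onto row \<open>c + k - d\<close>, and a row
  \<open>k < d\<close> into row \<open>c\<close> with a shift by \<open>d - k\<close>; on each column it is eventually the shift by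
  \<open>c - d\<close>. Hence stability under shifts is what is needed.\<close>

lemma zero_nhds_left_shift:
  assumes F: "shift_stable F" and G: "shift_stable G"
  shows "filterlim (\<lambda>x. a * x) (zero_nhds F G) (zero_nhds F G)"
  unfolding filterlim_iff
proof (intro allI impI)
  fix P assume P: "eventually P (zero_nhds F G)"
  then obtain n where zero: "P 0" and n: "\<And>k m. k > n \<Longrightarrow> m > n \<Longrightarrow> P (Elem (k, m))"
    and row: "\<And>k. \<forall>\<^sub>F m in F. P (Elem (k, m))" and col: "\<And>m. \<forall>\<^sub>F k in G. P (Elem (k, m))"
    by (auto simp: eventually_zero_nhds eventually_nhdsin_tau_min)
  show "\<forall>\<^sub>F x in zero_nhds F G. P (a * x)"
  proof (cases a rule: bicyclic0_cases)
    case zero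
    then show ?thesis using \<open>P 0\<close> by simp
  next
    case (Elem c d)
    have "P (a * Elem (k, m))" if "k > n + d" "m > n + d" for k m
      using that n [of "c + k - d" m] by (simp add: Elem)
    moreover have "\<forall>\<^sub>F m in F. P (a * Elem (k, m))" for k
    proof (cases "d \<le> k")
      case True
      then show ?thesis using row [of "c + k - d"] by (simp add: Elem)
    next
      case False
      have "\<forall>\<^sub>F m in F. P (Elem (c, m + (d - k)))"
        by (rule eventually_compose_filterlim [OF row shift_stableD(4) [OF F]])
      then show ?thesis using False by (simp add: Elem)
    qed
    moreover have "\<forall>\<^sub>F k in G. P (a * Elem (k, m))" for m
    proof -
      have "filterlim (\<lambda>k. k - d + c) G G"
        by (rule filterlim_compose [OF shift_stableD(4) [OF G] shift_stableD(5) [OF G]])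
      from eventually_compose_filterlim [OF col this]
      have "\<forall>\<^sub>F k in G. P (Elem (k - d + c, m))" .
      moreover have "\<forall>\<^sub>F k in G. d \<le> k"
        by (rule shift_stableD(2) [OF G])
      ultimately show ?thesis
        by eventually_elim (simp add: Elem add.commute)
    qed
    ultimately show ?thesis
      using zero by (auto simp: eventually_zero_nhds eventually_nhdsin_tau_min)
  qed
qed

lemma weak_nhds_zero_nhds:
  assumes F: "shift_stable F" and G: "shift_stable G"
  shows "weak_nhds (zero_nhds F G)"
  unfolding weak_nhds_def
proof (intro conjI allI impI)
  show "nhdsin tau_min 0 \<le> zero_nhds F G"
    by (simp add: zero_nhds_def)
next
  fix x :: bicyclic0 assume "x \<noteq> 0"
  then obtain a b where x: "x = Elem (a, b)"
    by (cases x rule: bicyclic0_cases) auto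
  show "\<forall>\<^sub>F y in zero_nhds F G. y \<noteq> x"
    unfolding eventually_zero_nhds
  proof (intro conjI allI)
    show "\<forall>\<^sub>F y in nhdsin tau_min 0. y \<noteq> x"
      by (auto simp: x eventually_nhdsin_tau_min)
    show "\<forall>\<^sub>F m in F. Elem (k, m) \<noteq> x" for k
      using shift_stableD(3) [OF F, of b] by (rule eventually_mono) (simp add: x)
    show "\<forall>\<^sub>F k in G. Elem (k, m) \<noteq> x" for m
      using shift_stableD(3) [OF G, of a] by (rule eventually_mono) (simp add: x)
  qed
next
  fix a
  show "filterlim (\<lambda>x. a * x) (zero_nhds F G) (zero_nhds F G)"
    by (rule zero_nhds_left_shift [OF F G])
  have "filterlim (\<lambda>x. flip a * x) (filtermap flip (zero_nhds F G)) (filtermap flip (zero_nhds F G))"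
    unfolding filtermap_flip_zero_nhds by (rule zero_nhds_left_shift [OF G F])
  then have "filterlim (\<lambda>x. flip (x * a)) (filtermap flip (zero_nhds F G)) (zero_nhds F G)"
    by (simp add: filterlim_filtermap flip_mult)
  from filterlim_flip [OF this] show "filterlim (\<lambda>x. x * a) (zero_nhds F G) (zero_nhds F G)"
    by simp
qed

text \<open>Any member of \<open>F\<close> can be prescribed on row \<open>0\<close> without a condition elsewhere, because each column
  meets row \<open>0\<close> in a single point, which \<open>G\<close> ignores.\<close>

lemma row_filter_zero_nhds:
  assumes G: "G \<le> sequentially"
  shows "row_filter (zero_nhds F G) = F"
proof (rule filter_eqI)
  fix P
  show "eventually P (row_filter (zero_nhds F G)) \<longleftrightarrow> eventually P F"
  proof
    assume "eventually P (row_filter (zero_nhds F G))"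
    then obtain Q where "\<forall>\<^sub>F m in F. Q (Elem (0, m))" "\<And>m. Q (Elem (0, m)) \<Longrightarrow> P m"
      by (auto simp: row_filter_def eventually_filtercomap eventually_zero_nhds)
    then show "eventually P F"
      by (auto elim: eventually_mono)
  next
    assume P: "eventually P F"
    let ?Q = "\<lambda>x. \<forall>m. x = Elem (0, m) \<longrightarrow> P m"
    have "\<forall>\<^sub>F k in G. k > 0"
      by (rule filter_leD [OF G eventually_gt_at_top])
    then have "\<forall>\<^sub>F k in G. ?Q (Elem (k, m))" for m
      by eventually_elim auto
    moreover have "\<forall>\<^sub>F m in F. ?Q (Elem (k, m))" for k
      using P by eventually_elim auto
    moreover have "eventually ?Q (nhdsin tau_min 0)"
      by (auto simp: eventually_nhdsin_tau_min)
    ultimately have "eventually ?Q (zero_nhds F G)"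
      unfolding eventually_zero_nhds by blast
    then show "eventually P (row_filter (zero_nhds F G))"
      by (auto simp: row_filter_def eventually_filtercomap)
  qed
qed

lemma col_filter_zero_nhds: "F \<le> sequentially \<Longrightarrow> col_filter (zero_nhds F G) = G"
  using row_filter_zero_nhds [of F G] row_filter_flip [of "zero_nhds F G"]
  by (simp add: filtermap_flip_zero_nhds)

text \<open>Beyond a corner, a set in \<open>zero_nhds (row_filter N) (col_filter N)\<close> is subject only to
  conditions on finitely many rows and columns, and \<open>eventually_row\<close> and \<open>eventually_col\<close> show
  that each of these holds eventually in \<open>N\<close>.\<close>

lemma zero_nhds_traces:
  assumes N: "weak_nhds N"
  shows "zero_nhds (row_filter N) (col_filter N) = N"
proof (rule antisym)
  show "zero_nhds (row_filter N) (col_filter N) \<le> N"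
    using weak_nhdsD(1) [OF N] filterlim_row [OF N] filterlim_col [OF N]
    by (auto simp: zero_nhds_def filterlim_def intro!: SUP_least)
  show "N \<le> zero_nhds (row_filter N) (col_filter N)"
  proof (rule filter_leI)
    fix P assume "eventually P (zero_nhds (row_filter N) (col_filter N))"
    then obtain n where zero: "P 0" and n: "\<And>k m. k > n \<Longrightarrow> m > n \<Longrightarrow> P (Elem (k, m))"
      and row: "\<And>k. \<forall>\<^sub>F m in row_filter N. P (Elem (k, m))"
      and col: "\<And>m. \<forall>\<^sub>F k in col_filter N. P (Elem (k, m))"
      by (auto simp: eventually_zero_nhds eventually_nhdsin_tau_min)
    have "\<forall>\<^sub>F x in N. \<forall>k\<in>{..n}. \<forall>m. x = Elem (k, m) \<longrightarrow> P x"
      using eventually_row [OF N row] by (intro eventually_ball_finite) auto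
    moreover have "\<forall>\<^sub>F x in N. \<forall>m\<in>{..n}. \<forall>k. x = Elem (k, m) \<longrightarrow> P x"
      using eventually_col [OF N col] by (intro eventually_ball_finite) auto
    ultimately show "eventually P N"
    proof eventually_elim
      case (elim x)
      then show ?case
        using zero n by (cases x rule: bicyclic0_cases) (auto simp: not_le)
    qed
  qed
qed


section \<open>The isomorphism\<close>

theorem theorem1p18:
  shows "order_isomorphic weak_topologies topology_le (SIF1 \<times> SIF1) (prod_le SIF1_le SIF1_le)"
proof -
  define row where "row \<tau> = row_filter (nhdsin \<tau> 0)" for \<tau> :: "bicyclic0 topology"
  define col where "col \<tau> = col_filter (nhdsin \<tau> 0)" for \<tau> :: "bicyclic0 topology"
  define f where "f \<tau> = (filter_code (row \<tau>), filter_code (col \<tau>))" for \<tau>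
  have traces: "zero_nhds (row \<tau>) (col \<tau>) = nhdsin \<tau> 0" if "\<tau> \<in> weak_topologies" for \<tau>
    using zero_nhds_traces [OF weak_nhds_nhdsin [OF that]] by (simp add: row_def col_def)
  have order: "topology_le \<sigma> \<tau> \<longleftrightarrow> prod_le SIF1_le SIF1_le (f \<sigma>) (f \<tau>)"
    if "\<sigma> \<in> weak_topologies" "\<tau> \<in> weak_topologies" for \<sigma> \<tau>
  proof -
    have "topology_le \<sigma> \<tau> \<longleftrightarrow> nhdsin \<tau> 0 \<le> nhdsin \<sigma> 0"
      by (rule topology_le_iff_nhdsin [OF that])
    also have "\<dots> \<longleftrightarrow> row \<tau> \<le> row \<sigma> \<and> col \<tau> \<le> col \<sigma>"
      using zero_nhds_mono [of "row \<tau>" "row \<sigma>" "col \<tau>" "col \<sigma>"]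
      by (auto simp: traces that)
        (simp_all add: row_def col_def row_filter_def col_filter_def filtercomap_mono)
    also have "\<dots> \<longleftrightarrow> prod_le SIF1_le SIF1_le (f \<sigma>) (f \<tau>)"
      by (simp add: f_def prod_le_def filter_code_le_iff)
    finally show ?thesis .
  qed
  \<comment> \<open>An order embedding of a partially ordered set is injective.\<close>
  have "inj_on f weak_topologies"
  proof (rule inj_onI)
    fix \<sigma> \<tau> assume "\<sigma> \<in> weak_topologies" "\<tau> \<in> weak_topologies" "f \<sigma> = f \<tau>"
    then have "topology_le \<sigma> \<tau>" "topology_le \<tau> \<sigma>"
      using order [of \<sigma> \<sigma>] order [of \<tau> \<tau>] order [of \<sigma> \<tau>] order [of \<tau> \<sigma>]
      by (simp_all add: topology_le_def)
    then show "\<sigma> = \<tau>"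
      by (auto simp: topology_eq topology_le_def)
  qed
  moreover have "f ` weak_topologies = SIF1 \<times> SIF1"
  proof
    show "f ` weak_topologies \<subseteq> SIF1 \<times> SIF1"
      using shift_stable_row_filter shift_stable_col_filter weak_nhds_nhdsin
      by (auto simp: f_def row_def col_def SIF1_eq)
    show "SIF1 \<times> SIF1 \<subseteq> f ` weak_topologies"
    proof
      fix p assume "p \<in> SIF1 \<times> SIF1"
      then obtain F G where FG: "shift_stable F" "shift_stable G"
        and p: "p = (filter_code F, filter_code G)"
        by (auto simp: SIF1_eq)
      have N: "weak_nhds (zero_nhds F G)"
        by (rule weak_nhds_zero_nhds [OF FG])
      then have "nhdsin (zero_topology (zero_nhds F G)) 0 = zero_nhds F G"
        using weak_nhds_at_zero by (intro nhdsin_zero_topology) blast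
      then have "f (zero_topology (zero_nhds F G)) = p"
        using FG by (simp add: f_def row_def col_def p row_filter_zero_nhds col_filter_zero_nhds
            shift_stable_def)
      then show "p \<in> f ` weak_topologies"
        using zero_topology_weak [OF N] by blast
    qed
  qed
  ultimately show ?thesis
    unfolding order_isomorphic_def bij_betw_def using order by blast
qed

end
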